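(* A closed sublocale of a compact regular locale (presented by a normal distributive lattice) is overt if and only if it is located.
   Context: Everything is constructive and predicative: intuitionistic logic, no axiom of choice (not even countable choice). A bounded distributive lattice $L$ is normal if for all $b_1,b_2$ with $b_1\vee b_2=1$ there are $c_1,c_2$ with $c_1\wedge c_2=0$, $c_1\vee b_1=1$ and $c_2\vee b_2=1$. Define $u\prec v$ ("$u$ is well inside $v$") to mean that there is $w$ with $u\wedge w=0$ and $v\vee w=1$. The compact regular locale presented by a normal distributive lattice $S$ has the elements of $S$ as basic opens, ordered by the lattice order, with covering relation: $x\vartriangleleft U$ ($x\in S$, $U\subseteq S$) iff for all $y\prec x$ there are finitely many $u_1,\dots,u_k\in U$ with $y\le u_1\vee\dots\vee u_k$. Compact regular locales are taken to be presented in this way. A covering relation on $(S,\le)$ is a relation $\vartriangleleft'$ between elements and subsets of $S$ satisfying: (Ref) $a\in U$ implies $a\vartriangleleft' U$; (Tra) $a\vartriangleleft' U$ and $u\vartriangleleft' V$ for all $u\in U$ imply $a\vartriangleleft' V$; (Loc) $a\vartriangleleft' U$, $a\vartriangleleft' V$ imply $a\vartriangleleft'\{x:\exists u\in U\,\exists v\in V\,(x\le u,\ x\le v)\}$; (Ext) $a\le b$ implies $a\vartriangleleft'\{b\}$. A sublocale is given by a covering relation containing $\vartriangleleft$. For $U\subseteq S$ the closed sublocale defined by the open $U$ (its complement) is given by $u\vartriangleleft' V$ iff $u\vartriangleleft V\cup U$. A sublocale with covering $\vartriangleleft'$ is overt if there is a positivity predicate: a subset $\mathrm{Pos}'\subseteq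 S$ such that $U\vartriangleleft'\{u\in U:\mathrm{Pos}'(u)\}$ for all $U\subseteq S$, and $\mathrm{Pos}'(u)$, $u\vartriangleleft' V$ imply $\mathrm{Pos}'(v)$ for some $v\in V$. A subset $\mathrm{Pos}\subseteq S$ is located if: (1) $v\prec u$ implies $v\notin\mathrm{Pos}$ or $u\in\mathrm{Pos}$; (2) $u\vartriangleleft U$ and $u\in\mathrm{Pos}$ imply $u'\in\mathrm{Pos}$ for some $u'\in U$. A closed sublocale $T$ is located if there is a located predicate $\mathrm{Pos}$ such that $T$ coincides (has the same covering relation) with the closed sublocale defined by the open $\neg\mathrm{Pos}=\{u\in S:u\notin\mathrm{Pos}\}$. *)

theory Defs
  imports Main
begin

text \<open>
  The mathematics formalised here is intuitionistic. Read in classical logic it would lose its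
  content, because classically every closed sublocale is both overt and located. All statements
  are therefore interpreted in Heyting-valued sets over an arbitrary frame \<open>'h\<close>: a proposition
  is an element of \<open>'h\<close>, the bold logical symbols are the Heyting operations of \<open>'h\<close>, and a
  statement \<^emph>\<open>holds\<close> if its truth value is the top element. Excluded middle and the axiom of
  choice (countable choice included) fail for suitable \<open>'h\<close>, so they are not available to a
  statement that holds for every \<open>'h\<close>. The instance \<open>'h = bool\<close> is the classical reading.
\<close>

section \<open>Heyting-valued logic\<close>

class frame = complete_lattice +
  assumes inf_Sup_distrib: "inf a (Sup B) = (SUP b\<in>B. inf a b)"

subclass (in complete_distrib_lattice) frame
  by standard (rule inf_Sup)

definition holds :: "'h::frame \<Rightarrow> bool"  ("\<turnstile> _" [5] 5)
  where "(\<turnstile> p) \<longleftrightarrow> p = top"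

abbreviation hfalse :: "'h::frame"  ("\<^bold>\<bottom>")
  where "\<^bold>\<bottom> \<equiv> bot"

abbreviation hconj :: "'h::frame \<Rightarrow> 'h \<Rightarrow> 'h"  (infixr "\<^bold>\<and>" 35)
  where "p \<^bold>\<and> q \<equiv> inf p q"

abbreviation hdisj :: "'h::frame \<Rightarrow> 'h \<Rightarrow> 'h"  (infixr "\<^bold>\<or>" 30)
  where "p \<^bold>\<or> q \<equiv> sup p q"

definition himp :: "'h::frame \<Rightarrow> 'h \<Rightarrow> 'h"  (infixr "\<^bold>\<longrightarrow>" 25)
  where "(p \<^bold>\<longrightarrow> q) = Sup {r. inf r p \<le> q}"

definition hiff :: "'h::frame \<Rightarrow> 'h \<Rightarrow> 'h"  (infixr "\<^bold>\<longleftrightarrow>" 25)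
  where "(p \<^bold>\<longleftrightarrow> q) = ((p \<^bold>\<longrightarrow> q) \<^bold>\<and> (q \<^bold>\<longrightarrow> p))"

definition hnot :: "'h::frame \<Rightarrow> 'h"  ("\<^bold>\<not> _" [40] 40)
  where "(\<^bold>\<not> p) = (p \<^bold>\<longrightarrow> \<^bold>\<bottom>)"

text \<open>A Heyting-valued subset \<open>A\<close> of a type is a function giving the truth value of \<open>x \<in> A\<close>.\<close>

definition hball :: "('b \<Rightarrow> 'h::frame) \<Rightarrow> ('b \<Rightarrow> 'h) \<Rightarrow> 'h"
  where "hball A P = (INF x. A x \<^bold>\<longrightarrow> P x)"

definition hbex :: "('b \<Rightarrow> 'h::frame) \<Rightarrow> ('b \<Rightarrow> 'h) \<Rightarrow> 'h"
  where "hbex A P = (SUP x. A x \<^bold>\<and> P x)"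

syntax
  "_hball" :: "pttrn \<Rightarrow> ('b \<Rightarrow> 'h) \<Rightarrow> 'h \<Rightarrow> 'h"  ("(3\<^bold>\<forall>_\<^bold>\<in>_./ _)" [0, 51, 10] 10)
  "_hbex" :: "pttrn \<Rightarrow> ('b \<Rightarrow> 'h) \<Rightarrow> 'h \<Rightarrow> 'h"  ("(3\<^bold>\<exists>_\<^bold>\<in>_./ _)" [0, 51, 10] 10)
translations
  "\<^bold>\<forall>x\<^bold>\<in>A. P" \<rightleftharpoons> "CONST hball A (\<lambda>x. P)"
  "\<^bold>\<exists>x\<^bold>\<in>A. P" \<rightleftharpoons> "CONST hbex A (\<lambda>x. P)"

lemma himp_adjoint: "r \<le> (p \<^bold>\<longrightarrow> q) \<longleftrightarrow> inf r p \<le> q" for p q r :: "'h::frame"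
proof
  assume "r \<le> (p \<^bold>\<longrightarrow> q)"
  then have "inf r p \<le> inf p (Sup {r. inf r p \<le> q})"
    unfolding himp_def by (simp add: inf.coboundedI1)
  also have "\<dots> \<le> q"
    unfolding inf_Sup_distrib by (auto intro!: SUP_least simp: inf.commute)
  finally show "inf r p \<le> q" .
qed (auto simp: himp_def intro: Sup_upper)

lemma bool_connectives:
  fixes p q :: bool and A P :: "'b \<Rightarrow> bool"
  shows "(\<turnstile> p) \<longleftrightarrow> p" "(p \<^bold>\<longrightarrow> q) \<longleftrightarrow> (p \<longrightarrow> q)"
    "(p \<^bold>\<longleftrightarrow> q) \<longleftrightarrow> (p \<longleftrightarrow> q)" "(\<^bold>\<not> p) \<longleftrightarrow> \<not> p"
    "(\<^bold>\<forall>x\<^bold>\<in>A. P x) \<longleftrightarrow> (\<forall>x. A x \<longrightarrow> P x)" "(\<^bold>\<exists>x\<^bold>\<in>A. P x) \<longleftrightarrow> (\<exists>x. A x \<and> P x)"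
  by (auto simp: holds_def himp_def hiff_def hnot_def hball_def hbex_def)


section \<open>Normal distributive lattices\<close>

text \<open>
  A Heyting-valued set is a type with a Heyting-valued membership predicate \<open>carr\<close> (the elements
  of the type are partial elements, with \<open>carr x\<close> the extent to which \<open>x\<close> exists) and a
  Heyting-valued equality \<open>eq\<close>, which need be neither two-valued nor decidable.
\<close>

record ('a, 'h) hlattice =
  carr :: "'a \<Rightarrow> 'h"
  eq :: "'a \<Rightarrow> 'a \<Rightarrow> 'h"
  meet :: "'a \<Rightarrow> 'a \<Rightarrow> 'a"
  join :: "'a \<Rightarrow> 'a \<Rightarrow> 'a"
  zero :: 'a
  one :: 'a

definition setoid :: "('a, 'h::frame) hlattice \<Rightarrow> 'h" where
  "setoid S =
    ((\<^bold>\<forall>x\<^bold>\<in>carr S. eq S x x) \<^bold>\<and>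
     (\<^bold>\<forall>x\<^bold>\<in>carr S. \<^bold>\<forall>y\<^bold>\<in>carr S. eq S x y \<^bold>\<longrightarrow> eq S y x) \<^bold>\<and>
     (\<^bold>\<forall>x\<^bold>\<in>carr S. \<^bold>\<forall>y\<^bold>\<in>carr S. \<^bold>\<forall>z\<^bold>\<in>carr S. eq S x y \<^bold>\<and> eq S y z \<^bold>\<longrightarrow> eq S x z))"

definition lattice_operations :: "('a, 'h::frame) hlattice \<Rightarrow> 'h" where
  "lattice_operations S =
    (carr S (zero S) \<^bold>\<and> carr S (one S) \<^bold>\<and>
     (\<^bold>\<forall>x\<^bold>\<in>carr S. \<^bold>\<forall>y\<^bold>\<in>carr S. carr S (meet S x y) \<^bold>\<and> carr S (join S x y)) \<^bold>\<and>
     (\<^bold>\<forall>x\<^bold>\<in>carr S. \<^bold>\<forall>x'\<^bold>\<in>carr S. \<^bold>\<forall>y\<^bold>\<in>carr S. \<^bold>\<forall>y'\<^bold>\<in>carr S. eq S x x' \<^bold>\<and> eq S y y' \<^bold>\<longrightarrow>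
        eq S (meet S x y) (meet S x' y') \<^bold>\<and> eq S (join S x y) (join S x' y')))"

definition bounded_distributive_lattice :: "('a, 'h::frame) hlattice \<Rightarrow> 'h" where
  "bounded_distributive_lattice S =
    (setoid S \<^bold>\<and> lattice_operations S \<^bold>\<and>
     (\<^bold>\<forall>x\<^bold>\<in>carr S. eq S (meet S x (one S)) x \<^bold>\<and> eq S (join S x (zero S)) x) \<^bold>\<and>
     (\<^bold>\<forall>x\<^bold>\<in>carr S. \<^bold>\<forall>y\<^bold>\<in>carr S.
        eq S (meet S x y) (meet S y x) \<^bold>\<and> eq S (join S x y) (join S y x) \<^bold>\<and>
        eq S (meet S x (join S x y)) x \<^bold>\<and> eq S (join S x (meet S x y)) x) \<^bold>\<and>
     (\<^bold>\<forall>x\<^bold>\<in>carr S. \<^bold>\<forall>y\<^bold>\<in>carr S. \<^bold>\<forall>z\<^bold>\<in>carr S.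
        eq S (meet S (meet S x y) z) (meet S x (meet S y z)) \<^bold>\<and>
        eq S (join S (join S x y) z) (join S x (join S y z)) \<^bold>\<and>
        eq S (meet S x (join S y z)) (join S (meet S x y) (meet S x z))))"

definition normal_distributive_lattice :: "('a, 'h::frame) hlattice \<Rightarrow> 'h" where
  "normal_distributive_lattice S =
    (bounded_distributive_lattice S \<^bold>\<and>
     (\<^bold>\<forall>b1\<^bold>\<in>carr S. \<^bold>\<forall>b2\<^bold>\<in>carr S. eq S (join S b1 b2) (one S) \<^bold>\<longrightarrow>
        (\<^bold>\<exists>c1\<^bold>\<in>carr S. \<^bold>\<exists>c2\<^bold>\<in>carr S.
           eq S (meet S c1 c2) (zero S) \<^bold>\<and>
           eq S (join S c1 b1) (one S) \<^bold>\<and> eq S (join S c2 b2) (one S))))"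

definition le :: "('a, 'h::frame) hlattice \<Rightarrow> 'a \<Rightarrow> 'a \<Rightarrow> 'h" where
  "le S x y = eq S (meet S x y) x"

definition well_inside :: "('a, 'h::frame) hlattice \<Rightarrow> 'a \<Rightarrow> 'a \<Rightarrow> 'h" where
  "well_inside S u v =
    (\<^bold>\<exists>w\<^bold>\<in>carr S. eq S (meet S u w) (zero S) \<^bold>\<and> eq S (join S v w) (one S))"


section \<open>Covering relations\<close>

text \<open>The truth value of \<open>U\<close> being a subset of \<open>S\<close>, i.e. of \<open>U\<close> respecting membership and equality.\<close>

definition subsets :: "('a, 'h::frame) hlattice \<Rightarrow> ('a \<Rightarrow> 'h) \<Rightarrow> 'h" where
  "subsets S U =
    ((\<^bold>\<forall>x\<^bold>\<in>U. carr S x) \<^bold>\<and>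
     (\<^bold>\<forall>x\<^bold>\<in>carr S. \<^bold>\<forall>y\<^bold>\<in>carr S. U x \<^bold>\<and> eq S x y \<^bold>\<longrightarrow> U y))"

definition union :: "('a \<Rightarrow> 'h::frame) \<Rightarrow> ('a \<Rightarrow> 'h) \<Rightarrow> 'a \<Rightarrow> 'h" where
  "union U V = (\<lambda>x. U x \<^bold>\<or> V x)"

definition singleton :: "('a, 'h::frame) hlattice \<Rightarrow> 'a \<Rightarrow> 'a \<Rightarrow> 'h" where
  "singleton S b = (\<lambda>x. carr S x \<^bold>\<and> eq S x b)"

definition common_refinement ::
    "('a, 'h::frame) hlattice \<Rightarrow> ('a \<Rightarrow> 'h) \<Rightarrow> ('a \<Rightarrow> 'h) \<Rightarrow> 'a \<Rightarrow> 'h" where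
  "common_refinement S U V =
    (\<lambda>x. carr S x \<^bold>\<and> (\<^bold>\<exists>u\<^bold>\<in>U. \<^bold>\<exists>v\<^bold>\<in>V. le S x u \<^bold>\<and> le S x v))"

text \<open>
  Finite families of elements of \<open>U\<close> are lists all of whose entries belong to \<open>U\<close>; ordinary lists
  suffice since the natural numbers of the Heyting-valued universe are the ordinary ones.
\<close>

definition finite_families :: "('a \<Rightarrow> 'h::frame) \<Rightarrow> 'a list \<Rightarrow> 'h" where
  "finite_families U us = (INF u\<in>set us. U u)"

definition finite_join :: "('a, 'h::frame) hlattice \<Rightarrow> 'a list \<Rightarrow> 'a" where
  "finite_join S us = foldr (join S) us (zero S)"

type_synonym ('a, 'h) relation = "'a \<Rightarrow> ('a \<Rightarrow> 'h) \<Rightarrow> 'h"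

definition cover :: "('a, 'h::frame) hlattice \<Rightarrow> ('a, 'h) relation" where
  "cover S x U =
    (\<^bold>\<forall>y\<^bold>\<in>carr S. well_inside S y x \<^bold>\<longrightarrow>
       (\<^bold>\<exists>us\<^bold>\<in>finite_families U. le S y (finite_join S us)))"

text \<open>
  Compatibility of a covering relation with equality of elements and of subsets
  need not be required: it follows from (Ref), (Tra) and (Ext).
\<close>

definition covering_relation :: "('a, 'h::frame) hlattice \<Rightarrow> ('a, 'h) relation \<Rightarrow> 'h" where
  "covering_relation S C =
    ((\<^bold>\<forall>a\<^bold>\<in>carr S. \<^bold>\<forall>U\<^bold>\<in>subsets S. U a \<^bold>\<longrightarrow> C a U) \<^bold>\<and>
     (\<^bold>\<forall>a\<^bold>\<in>carr S. \<^bold>\<forall>U\<^bold>\<in>subsets S. \<^bold>\<forall>V\<^bold>\<in>subsets S.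
        C a U \<^bold>\<and> (\<^bold>\<forall>u\<^bold>\<in>U. C u V) \<^bold>\<longrightarrow> C a V) \<^bold>\<and>
     (\<^bold>\<forall>a\<^bold>\<in>carr S. \<^bold>\<forall>U\<^bold>\<in>subsets S. \<^bold>\<forall>V\<^bold>\<in>subsets S.
        C a U \<^bold>\<and> C a V \<^bold>\<longrightarrow> C a (common_refinement S U V)) \<^bold>\<and>
     (\<^bold>\<forall>a\<^bold>\<in>carr S. \<^bold>\<forall>b\<^bold>\<in>carr S. le S a b \<^bold>\<longrightarrow> C a (singleton S b)))"


section \<open>Sublocales\<close>

definition sublocale_of :: "('a, 'h::frame) hlattice \<Rightarrow> ('a, 'h) relation \<Rightarrow> 'h" where
  "sublocale_of S T =
    (covering_relation S T \<^bold>\<and>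
     (\<^bold>\<forall>a\<^bold>\<in>carr S. \<^bold>\<forall>U\<^bold>\<in>subsets S. cover S a U \<^bold>\<longrightarrow> T a U))"

definition coincide ::
    "('a, 'h::frame) hlattice \<Rightarrow> ('a, 'h) relation \<Rightarrow> ('a, 'h) relation \<Rightarrow> 'h" where
  "coincide S T T' = (\<^bold>\<forall>a\<^bold>\<in>carr S. \<^bold>\<forall>V\<^bold>\<in>subsets S. T a V \<^bold>\<longleftrightarrow> T' a V)"

definition closed_complement ::
    "('a, 'h::frame) hlattice \<Rightarrow> ('a \<Rightarrow> 'h) \<Rightarrow> ('a, 'h) relation" where
  "closed_complement S U = (\<lambda>u V. cover S u (union V U))"

definition closed_sublocale :: "('a, 'h::frame) hlattice \<Rightarrow> ('a, 'h) relation \<Rightarrow> 'h" where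
  "closed_sublocale S T =
    (sublocale_of S T \<^bold>\<and> (\<^bold>\<exists>U\<^bold>\<in>subsets S. coincide S T (closed_complement S U)))"

definition positivity_predicate ::
    "('a, 'h::frame) hlattice \<Rightarrow> ('a, 'h) relation \<Rightarrow> ('a \<Rightarrow> 'h) \<Rightarrow> 'h" where
  "positivity_predicate S T Pos =
    (subsets S Pos \<^bold>\<and>
     (\<^bold>\<forall>U\<^bold>\<in>subsets S. \<^bold>\<forall>x\<^bold>\<in>U. T x (\<lambda>u. U u \<^bold>\<and> Pos u)) \<^bold>\<and>
     (\<^bold>\<forall>u\<^bold>\<in>carr S. \<^bold>\<forall>V\<^bold>\<in>subsets S. Pos u \<^bold>\<and> T u V \<^bold>\<longrightarrow> (\<^bold>\<exists>v\<^bold>\<in>V. Pos v)))"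

definition overt :: "('a, 'h::frame) hlattice \<Rightarrow> ('a, 'h) relation \<Rightarrow> 'h" where
  "overt S T = (\<^bold>\<exists>Pos\<^bold>\<in>subsets S. positivity_predicate S T Pos)"

definition located_predicate :: "('a, 'h::frame) hlattice \<Rightarrow> ('a \<Rightarrow> 'h) \<Rightarrow> 'h" where
  "located_predicate S Pos =
    (subsets S Pos \<^bold>\<and>
     (\<^bold>\<forall>u\<^bold>\<in>carr S. \<^bold>\<forall>v\<^bold>\<in>carr S. well_inside S v u \<^bold>\<longrightarrow> \<^bold>\<not> Pos v \<^bold>\<or> Pos u) \<^bold>\<and>
     (\<^bold>\<forall>u\<^bold>\<in>carr S. \<^bold>\<forall>U\<^bold>\<in>subsets S. cover S u U \<^bold>\<and> Pos u \<^bold>\<longrightarrow> (\<^bold>\<exists>u'\<^bold>\<in>U. Pos u')))"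

definition located :: "('a, 'h::frame) hlattice \<Rightarrow> ('a, 'h) relation \<Rightarrow> 'h" where
  "located S T =
    (\<^bold>\<exists>Pos\<^bold>\<in>subsets S. located_predicate S Pos \<^bold>\<and>
       coincide S T (closed_complement S (\<lambda>u. carr S u \<^bold>\<and> \<^bold>\<not> Pos u)))"

end

theory Submission
  imports Defs
begin

text \<open>
  Both directions use one and the same predicate: a positivity predicate of the closed sublocale
  is a located predicate defining it, and conversely.

  Let \<open>T\<close> be the complement of \<open>U\<close> and let \<open>Pos\<close> be a positivity predicate of \<open>T\<close>. Positivity
  says that \<open>u\<close> is covered in \<open>T\<close> by the part of \<open>{u}\<close> on which \<open>Pos\<close> holds, so \<open>u\<close> is covered by
  this part together with \<open>U\<close>. If \<open>v \<prec> u\<close>, then \<open>v\<close> lies below a finite join of such elements.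
  A finite family drawn from a union of two sets either lies in the second one or meets the first
  one, and this needs no excluded middle. If it meets the part of \<open>{u}\<close>, then \<open>Pos u\<close>. If
  it lies in \<open>U\<close>, then \<open>v\<close> is covered by the empty set in \<open>T\<close>, so \<open>\<not> Pos v\<close>. This disjunction is
  locatedness (lemma \<open>positivity_well_inside_cases\<close>). Moreover \<open>\<not> Pos u\<close> holds exactly if \<open>u\<close> is
  covered by the empty set in \<open>T\<close>, hence removing the negative opens removes exactly what
  removing \<open>U\<close> removes.

  Conversely, let \<open>Pos\<close> be located and let \<open>T\<close> be the complement of \<open>\<not> Pos\<close>. If \<open>x \<in> U\<close> and
  \<open>y \<prec> x\<close>, then either \<open>Pos x\<close>, and \<open>y\<close> lies below the positive element \<open>x\<close> of \<open>U\<close>, or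
  \<open>\<not> Pos y\<close>, and \<open>y\<close> lies below itself. Hence \<open>x\<close> is covered in \<open>T\<close> by the positive elements of
  \<open>U\<close>. And a positive element which is covered by \<open>V \<union> \<not> Pos\<close> has a positive element in its
  cover, which can only come from \<open>V\<close>.

  The proof is carried out by Kripke-Joyal forcing: an element \<open>r\<close> of the frame is a stage, and
  \<open>r \<le> p\<close> means that \<open>p\<close> holds at stage \<open>r\<close>. What holds at a stage holds at every smaller one.
  Implications and universal quantifiers are proved at all smaller stages, and a disjunction or an
  existential statement may be used by passing to smaller stages where an alternative or a
  witness is given. The lemmas below are therefore stated at an arbitrary stage, and local facts
  named after a stage, such as \<open>at_s\<close>, move a fact down to it.
\<close>

section \<open>Forcing\<close>

lemma himpI:
  fixes r :: "'h::frame"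
  assumes "\<And>s. s \<le> r \<Longrightarrow> s \<le> p \<Longrightarrow> s \<le> q"
  shows "r \<le> (p \<^bold>\<longrightarrow> q)"
  unfolding himp_adjoint by (rule assms) auto

lemma himpD:
  fixes r :: "'h::frame"
  assumes "r \<le> (p \<^bold>\<longrightarrow> q)" "r \<le> p"
  shows "r \<le> q"
  using assms unfolding himp_adjoint by (metis inf.absorb1)

lemma hnotI:
  fixes r :: "'h::frame"
  assumes "\<And>s. s \<le> r \<Longrightarrow> s \<le> p \<Longrightarrow> s \<le> bot"
  shows "r \<le> (\<^bold>\<not> p)"
  unfolding hnot_def using assms by (rule himpI)

lemma hnotD:
  fixes r :: "'h::frame"
  assumes "r \<le> (\<^bold>\<not> p)" "r \<le> p"
  shows "r \<le> q"
  using himpD[OF assms[unfolded hnot_def]] by (simp add: bot_unique)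

lemma hiffI:
  fixes r :: "'h::frame"
  assumes "\<And>s. s \<le> r \<Longrightarrow> s \<le> p \<Longrightarrow> s \<le> q" "\<And>s. s \<le> r \<Longrightarrow> s \<le> q \<Longrightarrow> s \<le> p"
  shows "r \<le> (p \<^bold>\<longleftrightarrow> q)"
  unfolding hiff_def using assms by (auto intro: himpI)

lemma hballI:
  fixes r :: "'h::frame"
  assumes "\<And>x s. s \<le> r \<Longrightarrow> s \<le> A x \<Longrightarrow> s \<le> P x"
  shows "r \<le> hball A P"
  unfolding hball_def by (intro INF_greatest himpI assms)

lemma hballD:
  fixes r :: "'h::frame"
  assumes "r \<le> hball A P" "r \<le> A x"
  shows "r \<le> P x"
proof -
  have "r \<le> (A x \<^bold>\<longrightarrow> P x)"
    using assms(1) unfolding hball_def by (meson INF_lower UNIV_I order_trans)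
  then show ?thesis using assms(2) by (rule himpD)
qed

lemma hbexI:
  fixes r :: "'h::frame"
  assumes "r \<le> A x" "r \<le> P x"
  shows "r \<le> hbex A P"
  unfolding hbex_def using assms by (meson SUP_upper UNIV_I le_inf_iff order_trans)

lemma hbexE:
  fixes r :: "'h::frame"
  assumes "r \<le> hbex A P"
    and "\<And>x s. s \<le> r \<Longrightarrow> s \<le> A x \<Longrightarrow> s \<le> P x \<Longrightarrow> s \<le> q"
  shows "r \<le> q"
proof -
  have "r = inf r (hbex A P)"
    using assms(1) by (simp add: inf.absorb1)
  also have "\<dots> = (SUP x. inf r (inf (A x) (P x)))"
    unfolding hbex_def inf_Sup_distrib by (simp add: image_image)
  also have "\<dots> \<le> q"
    by (intro SUP_least assms(2)) (auto intro: le_infI1 le_infI2)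
  finally show ?thesis .
qed

lemma hdisjE:
  fixes r :: "'h::frame"
  assumes "r \<le> (p1 \<^bold>\<or> p2)"
    and "\<And>s. s \<le> r \<Longrightarrow> s \<le> p1 \<Longrightarrow> s \<le> q" "\<And>s. s \<le> r \<Longrightarrow> s \<le> p2 \<Longrightarrow> s \<le> q"
  shows "r \<le> q"
proof -
  have "r = inf r (Sup {p1, p2})"
    using assms(1) by (simp add: inf.absorb1)
  also have "\<dots> = sup (inf r p1) (inf r p2)"
    unfolding inf_Sup_distrib by simp
  also have "\<dots> \<le> q"
    by (intro sup_least assms) auto
  finally show ?thesis .
qed

lemma unionE:
  fixes r :: "'h::frame"
  assumes "r \<le> union U V x"
    and "\<And>s. s \<le> r \<Longrightarrow> s \<le> U x \<Longrightarrow> s \<le> q" "\<And>s. s \<le> r \<Longrightarrow> s \<le> V x \<Longrightarrow> s \<le> q"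
  shows "r \<le> q"
  using assms unfolding union_def by (rule hdisjE)

lemma unionI1: "r \<le> U x \<Longrightarrow> r \<le> union U V x"
  and unionI2: "r \<le> V x \<Longrightarrow> r \<le> union U V x"
  for r :: "'h::frame"
  by (simp_all add: union_def le_supI1 le_supI2)


section \<open>Subsets and finite families\<close>

lemma subsetsI:
  fixes r :: "'h::frame"
  assumes "\<And>x s. s \<le> r \<Longrightarrow> s \<le> U x \<Longrightarrow> s \<le> carr S x"
    and "\<And>x y s. \<lbrakk>s \<le> r; s \<le> carr S x; s \<le> carr S y; s \<le> U x; s \<le> eq S x y\<rbrakk> \<Longrightarrow> s \<le> U y"
  shows "r \<le> subsets S U"
proof -
  have "t \<le> U y" if "t \<le> s" "s \<le> s'" "s' \<le> r" "s' \<le> carr S x" "s \<le> carr S y"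
    "t \<le> (U x \<^bold>\<and> eq S x y)" for x y s s' t
    by (rule assms(2)[of t x y]) (use that in \<open>auto intro: order_trans\<close>)
  then show ?thesis
    unfolding subsets_def by (auto intro!: hballI himpI assms(1) simp del: le_inf_iff simp: le_inf_iff[of r])
qed

lemma subsets_carr: "r \<le> subsets S U \<Longrightarrow> r \<le> U x \<Longrightarrow> r \<le> carr S x"
  for r :: "'h::frame"
  unfolding subsets_def by (auto dest: hballD)

lemma subsets_eq:
  fixes r :: "'h::frame"
  assumes U: "r \<le> subsets S U" and x: "r \<le> U x" and y: "r \<le> carr S y" and e: "r \<le> eq S x y"
  shows "r \<le> U y"
proof -
  have "r \<le> (\<^bold>\<forall>x\<^bold>\<in>carr S. \<^bold>\<forall>y\<^bold>\<in>carr S. U x \<^bold>\<and> eq S x y \<^bold>\<longrightarrow> U y)"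
    using U by (simp add: subsets_def)
  from this[THEN hballD, OF subsets_carr[OF U x], THEN hballD, OF y]
  have "r \<le> (U x \<^bold>\<and> eq S x y \<^bold>\<longrightarrow> U y)" .
  then show ?thesis using x e by (auto dest: himpD)
qed

lemma subsets_union:
  fixes r :: "'h::frame"
  assumes "r \<le> subsets S U" "r \<le> subsets S V"
  shows "r \<le> subsets S (union U V)"
proof (rule subsetsI)
  fix x s assume "s \<le> r" and x: "s \<le> union U V x"
  show "s \<le> carr S x"
    using x by (rule unionE) (meson assms order_trans subsets_carr \<open>s \<le> r\<close>)+
next
  fix x y s assume s: "s \<le> r" "s \<le> carr S y" "s \<le> eq S x y" and x: "s \<le> union U V x"
  from x show "s \<le> union U V y"
  proof (rule unionE)
    fix t assume t: "t \<le> s" "t \<le> U x"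
    note at_t = order_trans[OF t(1)]
    have "t \<le> U y"
      using at_t[OF order_trans[OF s(1) assms(1)]] t(2) at_t[OF s(2)] at_t[OF s(3)]
      by (rule subsets_eq)
    then show "t \<le> union U V y" by (rule unionI1)
  next
    fix t assume t: "t \<le> s" "t \<le> V x"
    note at_t = order_trans[OF t(1)]
    have "t \<le> V y"
      using at_t[OF order_trans[OF s(1) assms(2)]] t(2) at_t[OF s(2)] at_t[OF s(3)]
      by (rule subsets_eq)
    then show "t \<le> union U V y" by (rule unionI2)
  qed
qed

lemma subsets_inter:
  fixes r :: "'h::frame"
  assumes "r \<le> subsets S U" "r \<le> subsets S V"
  shows "r \<le> subsets S (\<lambda>x. U x \<^bold>\<and> V x)"
proof (rule subsetsI)
  fix x s assume s: "s \<le> r" "s \<le> (U x \<^bold>\<and> V x)"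
  then have "s \<le> U x" by simp
  with order_trans[OF s(1) assms(1)] show "s \<le> carr S x"
    by (rule subsets_carr)
next
  fix x y s
  assume s: "s \<le> r" and xy: "s \<le> carr S y" "s \<le> eq S x y" and x: "s \<le> (U x \<^bold>\<and> V x)"
  have "s \<le> U x" "s \<le> V x" using x by simp_all
  then show "s \<le> (U y \<^bold>\<and> V y)"
    using subsets_eq[OF order_trans[OF s assms(1)] _ xy] subsets_eq[OF order_trans[OF s assms(2)] _ xy]
    by simp
qed

lemma subsets_empty: "r \<le> subsets S (\<lambda>x. \<^bold>\<bottom>)" for r :: "'h::frame"
  by (rule subsetsI) (auto simp: bot_unique)

text \<open>
  A finite family is inspected entry by entry, so this case distinction is constructive. It is the
  source of the disjunction in the definition of locatedness.
\<close>

lemma finite_families_union_cases: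
  "finite_families (union U V) us \<le> ((\<^bold>\<exists>x\<^bold>\<in>U. top) \<^bold>\<or> finite_families V us)"
proof (induction us)
  case Nil
  show ?case by (simp add: finite_families_def)
next
  case (Cons a us)
  let ?E = "\<^bold>\<exists>x\<^bold>\<in>U. top" and ?r = "finite_families (union U V) (a # us)"
  have a: "?r \<le> union U V a" and us: "?r \<le> finite_families (union U V) us"
    by (simp_all add: finite_families_def)
  from a show ?case
  proof (rule unionE)
    fix s assume "s \<le> U a"
    then show "s \<le> (?E \<^bold>\<or> finite_families V (a # us))"
      by (auto intro!: le_supI1 hbexI)
  next
    fix s assume "s \<le> ?r" and Va: "s \<le> V a"
    then have "s \<le> (?E \<^bold>\<or> finite_families V us)"
      using us Cons.IH by (meson order_trans)
    then show "s \<le> (?E \<^bold>\<or> finite_families V (a # us))"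
    proof (rule hdisjE)
      fix t assume "t \<le> s" "t \<le> finite_families V us"
      then have "t \<le> finite_families V (a # us)"
        using Va by (auto simp: finite_families_def)
      then show "t \<le> (?E \<^bold>\<or> finite_families V (a # us))" by (rule le_supI2)
    qed (rule le_supI1)
  qed
qed

lemma finite_families_mono:
  fixes r :: "'h::frame"
  assumes "r \<le> finite_families U us" "\<And>x s. s \<le> r \<Longrightarrow> s \<le> U x \<Longrightarrow> s \<le> V x"
  shows "r \<le> finite_families V us"
  using assms by (simp add: finite_families_def le_INF_iff)


section \<open>Lattice order\<close>

text \<open>
  The lattice axioms are Horn clauses, so at each stage the elements existing there form an
  ordinary distributive lattice with respect to the equality of that stage.
\<close>

locale lattice_at_stage =
  fixes S :: "('a, 'h::frame) hlattice" and r :: 'h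
  assumes lattice: "r \<le> bounded_distributive_lattice S"
begin

lemma eq_refl: "r \<le> carr S x \<Longrightarrow> r \<le> eq S x x"
  using lattice unfolding bounded_distributive_lattice_def setoid_def by (auto dest: hballD)

lemma eq_sym:
  assumes "r \<le> carr S x" "r \<le> carr S y" "r \<le> eq S x y"
  shows "r \<le> eq S y x"
proof -
  have "r \<le> (\<^bold>\<forall>x\<^bold>\<in>carr S. \<^bold>\<forall>y\<^bold>\<in>carr S. eq S x y \<^bold>\<longrightarrow> eq S y x)"
    using lattice by (simp add: bounded_distributive_lattice_def setoid_def)
  from this[THEN hballD, OF assms(1), THEN hballD, OF assms(2), THEN himpD, OF assms(3)] show ?thesis .
qed

lemma eq_trans:
  assumes "r \<le> carr S x" "r \<le> carr S y" "r \<le> carr S z" "r \<le> eq S x y" "r \<le> eq S y z"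
  shows "r \<le> eq S x z"
proof -
  have "r \<le> (\<^bold>\<forall>x\<^bold>\<in>carr S. \<^bold>\<forall>y\<^bold>\<in>carr S. \<^bold>\<forall>z\<^bold>\<in>carr S.
      eq S x y \<^bold>\<and> eq S y z \<^bold>\<longrightarrow> eq S x z)"
    using lattice by (simp add: bounded_distributive_lattice_def setoid_def)
  from this[THEN hballD, OF assms(1), THEN hballD, OF assms(2), THEN hballD, OF assms(3)] show ?thesis
    by (rule himpD) (simp add: assms)
qed

lemma zero_carr: "r \<le> carr S (zero S)"
  and one_carr: "r \<le> carr S (one S)"
  using lattice by (simp_all add: bounded_distributive_lattice_def lattice_operations_def)

lemma operations_carr:
  assumes "r \<le> carr S x" "r \<le> carr S y"
  shows "r \<le> carr S (meet S x y)" "r \<le> carr S (join S x y)"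
proof -
  have "r \<le> (\<^bold>\<forall>x\<^bold>\<in>carr S. \<^bold>\<forall>y\<^bold>\<in>carr S. carr S (meet S x y) \<^bold>\<and> carr S (join S x y))"
    using lattice by (simp add: bounded_distributive_lattice_def lattice_operations_def)
  from this[THEN hballD, OF assms(1), THEN hballD, OF assms(2)]
  show "r \<le> carr S (meet S x y)" "r \<le> carr S (join S x y)" by auto
qed

lemma operations_cong:
  assumes "r \<le> carr S x" "r \<le> carr S x'" "r \<le> carr S y" "r \<le> carr S y'"
    and "r \<le> eq S x x'" "r \<le> eq S y y'"
  shows "r \<le> eq S (meet S x y) (meet S x' y')" "r \<le> eq S (join S x y) (join S x' y')"
proof -
  have "r \<le> (\<^bold>\<forall>x\<^bold>\<in>carr S. \<^bold>\<forall>x'\<^bold>\<in>carr S. \<^bold>\<forall>y\<^bold>\<in>carr S. \<^bold>\<forall>y'\<^bold>\<in>carr S.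
      eq S x x' \<^bold>\<and> eq S y y' \<^bold>\<longrightarrow>
        eq S (meet S x y) (meet S x' y') \<^bold>\<and> eq S (join S x y) (join S x' y'))"
    using lattice by (simp add: bounded_distributive_lattice_def lattice_operations_def)
  from this[THEN hballD, OF assms(1), THEN hballD, OF assms(2), THEN hballD, OF assms(3), THEN hballD, OF assms(4)]
  have "r \<le> (eq S (meet S x y) (meet S x' y') \<^bold>\<and> eq S (join S x y) (join S x' y'))"
    by (rule himpD) (simp add: assms)
  then show "r \<le> eq S (meet S x y) (meet S x' y')" "r \<le> eq S (join S x y) (join S x' y')"
    by auto
qed

lemma units:
  assumes "r \<le> carr S x"
  shows "r \<le> eq S (meet S x (one S)) x" "r \<le> eq S (join S x (zero S)) x"
proof -
  have "r \<le> (\<^bold>\<forall>x\<^bold>\<in>carr S. eq S (meet S x (one S)) x \<^bold>\<and> eq S (join S x (zero S)) x)"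
    using lattice by (simp add: bounded_distributive_lattice_def)
  from this[THEN hballD, OF assms]
  show "r \<le> eq S (meet S x (one S)) x" "r \<le> eq S (join S x (zero S)) x" by auto
qed

lemma absorption:
  assumes "r \<le> carr S x" "r \<le> carr S y"
  shows "r \<le> eq S (meet S x (join S x y)) x"
proof -
  have "r \<le> (\<^bold>\<forall>x\<^bold>\<in>carr S. \<^bold>\<forall>y\<^bold>\<in>carr S.
        eq S (meet S x y) (meet S y x) \<^bold>\<and> eq S (join S x y) (join S y x) \<^bold>\<and>
        eq S (meet S x (join S x y)) x \<^bold>\<and> eq S (join S x (meet S x y)) x)"
    using lattice by (simp add: bounded_distributive_lattice_def)
  from this[THEN hballD, OF assms(1), THEN hballD, OF assms(2)] show ?thesis by auto
qed

lemma meet_assoc_distrib: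
  assumes "r \<le> carr S x" "r \<le> carr S y" "r \<le> carr S z"
  shows "r \<le> eq S (meet S (meet S x y) z) (meet S x (meet S y z))"
    and "r \<le> eq S (meet S x (join S y z)) (join S (meet S x y) (meet S x z))"
proof -
  have "r \<le> (\<^bold>\<forall>x\<^bold>\<in>carr S. \<^bold>\<forall>y\<^bold>\<in>carr S. \<^bold>\<forall>z\<^bold>\<in>carr S.
        eq S (meet S (meet S x y) z) (meet S x (meet S y z)) \<^bold>\<and>
        eq S (join S (join S x y) z) (join S x (join S y z)) \<^bold>\<and>
        eq S (meet S x (join S y z)) (join S (meet S x y) (meet S x z)))"
    using lattice by (simp add: bounded_distributive_lattice_def)
  from this[THEN hballD, OF assms(1), THEN hballD, OF assms(2), THEN hballD, OF assms(3)]
  show "r \<le> eq S (meet S (meet S x y) z) (meet S x (meet S y z))"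
    and "r \<le> eq S (meet S x (join S y z)) (join S (meet S x y) (meet S x z))" by auto
qed

lemma le_trans:
  assumes x: "r \<le> carr S x" and y: "r \<le> carr S y" and z: "r \<le> carr S z"
    and xy: "r \<le> le S x y" and yz: "r \<le> le S y z"
  shows "r \<le> le S x z"
proof -
  note c = x y z operations_carr
  have 1: "r \<le> eq S (meet S x z) (meet S (meet S x y) z)"
    using xy by (intro operations_cong(1) eq_sym[of "meet S x y" x] eq_refl[of z] c)
      (simp_all add: le_def)
  have 2: "r \<le> eq S (meet S (meet S x y) z) (meet S x (meet S y z))"
    by (intro meet_assoc_distrib c)
  have 3: "r \<le> eq S (meet S x (meet S y z)) (meet S x y)"
    using yz by (intro operations_cong(1) eq_refl[of x] c) (simp_all add: le_def)
  have 4: "r \<le> eq S (meet S x y) x"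
    using xy by (simp add: le_def)
  show ?thesis
    unfolding le_def
    by (rule eq_trans[OF _ _ _ 1 eq_trans[OF _ _ _ 2 eq_trans[OF _ _ _ 3 4]]]) (intro c)+
qed

lemma le_finite_join_singleton:
  assumes "r \<le> carr S x"
  shows "r \<le> le S x (finite_join S [x])"
  using absorption[OF assms zero_carr] by (simp add: le_def finite_join_def)

lemma finite_join_carr:
  assumes "r \<le> finite_families (carr S) us"
  shows "r \<le> carr S (finite_join S us)"
  using assms
  by (induction us) (auto simp: finite_families_def finite_join_def zero_carr operations_carr)

text \<open>If \<open>y \<and> w = 0\<close> and \<open>x \<or> w = 1\<close>, then \<open>y = y \<and> (x \<or> w) = (y \<and> x) \<or> (y \<and> w) = y \<and> x\<close>.\<close>

lemma le_if_complement:
  assumes y: "r \<le> carr S y" and x: "r \<le> carr S x" and w: "r \<le> carr S w"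
    and yw: "r \<le> eq S (meet S y w) (zero S)" and xw: "r \<le> eq S (join S x w) (one S)"
  shows "r \<le> le S y x"
proof -
  note c = x y w operations_carr zero_carr one_carr
  have 1: "r \<le> eq S y (meet S y (one S))"
    by (rule eq_sym) (intro units c)+
  have 2: "r \<le> eq S (meet S y (one S)) (meet S y (join S x w))"
    by (intro operations_cong(1) eq_sym[OF _ _ xw] eq_refl[of y] c)
  have 3: "r \<le> eq S (meet S y (join S x w)) (join S (meet S y x) (meet S y w))"
    by (intro meet_assoc_distrib c)
  have 4: "r \<le> eq S (join S (meet S y x) (meet S y w)) (join S (meet S y x) (zero S))"
    by (intro operations_cong(2) yw eq_refl[of "meet S y x"] c)
  have 5: "r \<le> eq S (join S (meet S y x) (zero S)) (meet S y x)"
    by (intro units c)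
  have "r \<le> eq S y (meet S y x)"
    by (rule eq_trans[OF _ _ _ 1 eq_trans[OF _ _ _ 2 eq_trans[OF _ _ _ 3 eq_trans[OF _ _ _ 4 5]]]])
      (intro c)+
  then show ?thesis
    unfolding le_def by (rule eq_sym[rotated 2]) (intro c)+
qed

end

lemma le_if_well_inside:
  fixes r :: "'h::frame"
  assumes S: "r \<le> bounded_distributive_lattice S"
    and y: "r \<le> carr S y" and x: "r \<le> carr S x" and yx: "r \<le> well_inside S y x"
  shows "r \<le> le S y x"
  using yx unfolding well_inside_def
proof (rule hbexE)
  fix w s assume "s \<le> r" and w: "s \<le> carr S w"
    "s \<le> (eq S (meet S y w) (zero S) \<^bold>\<and> eq S (join S x w) (one S))"
  then interpret lattice_at_stage S s
    using S by unfold_locales (rule order_trans)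
  show "s \<le> le S y x"
    by (rule le_if_complement[of y x w]) (use w order_trans[OF \<open>s \<le> r\<close>] x y in auto)
qed

lemma subsets_singleton:
  fixes r :: "'h::frame"
  assumes S: "r \<le> bounded_distributive_lattice S" and u: "r \<le> carr S u"
  shows "r \<le> subsets S (singleton S u)"
proof (rule subsetsI)
  fix x y s
  assume s: "s \<le> r" "s \<le> carr S x" "s \<le> carr S y" "s \<le> singleton S u x" "s \<le> eq S x y"
  interpret lattice_at_stage S s
    using S s(1) by unfold_locales (rule order_trans)
  show "s \<le> singleton S u y"
    using s order_trans[OF s(1) u] eq_trans[of y x u] eq_sym[of x y] by (auto simp: singleton_def)
qed (simp add: singleton_def)


section \<open>The covering relation of a compact regular locale\<close>

lemma cover_if_le_finite_join:
  fixes r :: "'h::frame"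
  assumes S: "r \<le> bounded_distributive_lattice S"
    and U: "r \<le> subsets S U" and a: "r \<le> carr S a"
    and us: "r \<le> finite_families U us" and le: "r \<le> le S a (finite_join S us)"
  shows "r \<le> cover S a U"
  unfolding cover_def
proof (intro hballI himpI)
  fix y s t assume "s \<le> r" "t \<le> s" and y: "s \<le> carr S y" and ya: "t \<le> well_inside S y a"
  note at_t = order_trans[OF order_trans[OF \<open>t \<le> s\<close> \<open>s \<le> r\<close>]]
  interpret lattice_at_stage S t
    using at_t[OF S] by unfold_locales
  have y: "t \<le> carr S y"
    using \<open>t \<le> s\<close> y by (rule order_trans)
  have "t \<le> finite_families (carr S) us"
    using at_t[OF us] by (rule finite_families_mono) (meson at_t[OF U] order_trans subsets_carr)
  then have "t \<le> carr S (finite_join S us)"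
    by (rule finite_join_carr)
  moreover have "t \<le> le S y a"
    using lattice y at_t[OF a] ya by (rule le_if_well_inside)
  ultimately have "t \<le> le S y (finite_join S us)"
    using le_trans[OF y at_t[OF a]] at_t[OF le] by blast
  then show "t \<le> (\<^bold>\<exists>us\<^bold>\<in>finite_families U. le S y (finite_join S us))"
    using at_t[OF us] by (intro hbexI)
qed

lemma cover_refl:
  fixes r :: "'h::frame"
  assumes S: "r \<le> bounded_distributive_lattice S" and U: "r \<le> subsets S U" and a: "r \<le> U a"
  shows "r \<le> cover S a U"
proof -
  interpret lattice_at_stage S r
    using S by unfold_locales
  have "r \<le> carr S a"
    using U a by (rule subsets_carr)
  moreover have "r \<le> finite_families U [a]"
    using a by (simp add: finite_families_def)
  ultimately show ?thesis
    using cover_if_le_finite_join[OF S U] le_finite_join_singleton by blast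
qed

lemma coverD:
  fixes r :: "'h::frame"
  assumes "r \<le> cover S a U" "r \<le> carr S y" "r \<le> well_inside S y a"
  shows "r \<le> (\<^bold>\<exists>us\<^bold>\<in>finite_families U. le S y (finite_join S us))"
  using assms(1)[unfolded cover_def, THEN hballD, OF assms(2), THEN himpD, OF assms(3)] .

lemma cover_mono:
  fixes r :: "'h::frame"
  assumes "r \<le> cover S a U" "\<And>x s. s \<le> r \<Longrightarrow> s \<le> U x \<Longrightarrow> s \<le> V x"
  shows "r \<le> cover S a V"
  unfolding cover_def
proof (intro hballI himpI)
  fix y s t assume *: "s \<le> r" "t \<le> s" "s \<le> carr S y" "t \<le> well_inside S y a"
  then have "t \<le> (\<^bold>\<exists>us\<^bold>\<in>finite_families U. le S y (finite_join S us))"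
    by (intro coverD[of t S a U y]) (meson assms(1) order_trans)+
  then show "t \<le> (\<^bold>\<exists>us\<^bold>\<in>finite_families V. le S y (finite_join S us))"
  proof (rule hbexE)
    fix us t' assume t': "t' \<le> t" "t' \<le> finite_families U us" "t' \<le> le S y (finite_join S us)"
    have "t' \<le> finite_families V us"
      using t'(2) by (rule finite_families_mono) (meson assms(2) * t'(1) order_trans)
    then show "t' \<le> (\<^bold>\<exists>us\<^bold>\<in>finite_families V. le S y (finite_join S us))"
      using t'(3) by (rule hbexI)
  qed
qed


section \<open>Closed sublocales\<close>

lemma coincide_iff:
  fixes r :: "'h::frame"
  assumes "r \<le> coincide S T T'" "r \<le> carr S a" "r \<le> subsets S V"
  shows "r \<le> T a V \<longleftrightarrow> r \<le> T' a V"
proof -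
  from assms(1)[unfolded coincide_def, THEN hballD, OF assms(2), THEN hballD, OF assms(3)]
  have "r \<le> (T a V \<^bold>\<longleftrightarrow> T' a V)" .
  then show ?thesis
    unfolding hiff_def by (auto dest: himpD)
qed

lemma sublocale_cover:
  fixes r :: "'h::frame"
  assumes "r \<le> sublocale_of S T" "r \<le> carr S a" "r \<le> subsets S U" "r \<le> cover S a U"
  shows "r \<le> T a U"
proof -
  have "r \<le> (\<^bold>\<forall>a\<^bold>\<in>carr S. \<^bold>\<forall>U\<^bold>\<in>subsets S. cover S a U \<^bold>\<longrightarrow> T a U)"
    using assms(1) by (simp add: sublocale_of_def)
  from this[THEN hballD, OF assms(2), THEN hballD, OF assms(3), THEN himpD, OF assms(4)] show ?thesis .
qed

lemma sublocale_trans: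
  fixes r :: "'h::frame"
  assumes "r \<le> sublocale_of S T" "r \<le> carr S a" "r \<le> subsets S U" "r \<le> subsets S V"
    and "r \<le> T a U" "\<And>u s. s \<le> r \<Longrightarrow> s \<le> U u \<Longrightarrow> s \<le> T u V"
  shows "r \<le> T a V"
proof -
  have "r \<le> (\<^bold>\<forall>a\<^bold>\<in>carr S. \<^bold>\<forall>U\<^bold>\<in>subsets S. \<^bold>\<forall>V\<^bold>\<in>subsets S.
        T a U \<^bold>\<and> (\<^bold>\<forall>u\<^bold>\<in>U. T u V) \<^bold>\<longrightarrow> T a V)"
    using assms(1) by (simp add: sublocale_of_def covering_relation_def)
  from this[THEN hballD, OF assms(2), THEN hballD, OF assms(3), THEN hballD, OF assms(4)] show ?thesis
    by (rule himpD) (simp add: assms(5) hballI[OF assms(6)])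
qed

lemma sublocale_refl:
  fixes r :: "'h::frame"
  assumes "r \<le> bounded_distributive_lattice S" "r \<le> sublocale_of S T"
    and "r \<le> subsets S U" "r \<le> U a"
  shows "r \<le> T a U"
  using assms(2) subsets_carr[OF assms(3,4)] assms(3) cover_refl[OF assms(1,3,4)]
  by (rule sublocale_cover)

text \<open>
  The positive part of \<open>{u}\<close> has an element only to the extent that \<open>Pos u\<close> holds. It takes the
  place of the case distinction whether \<open>u\<close> is positive, which is not available.
\<close>

lemma positivity_singleton:
  fixes r :: "'h::frame"
  assumes "r \<le> bounded_distributive_lattice S" "r \<le> positivity_predicate S T Pos" "r \<le> carr S u"
  shows "r \<le> T u (\<lambda>x. singleton S u x \<^bold>\<and> Pos x)"
proof -
  interpret lattice_at_stage S r
    using assms(1) by unfold_locales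
  have "r \<le> (\<^bold>\<forall>U\<^bold>\<in>subsets S. \<^bold>\<forall>x\<^bold>\<in>U. T x (\<lambda>u. U u \<^bold>\<and> Pos u))"
    using assms(2) by (simp add: positivity_predicate_def)
  note positive = this[THEN hballD, OF subsets_singleton[OF assms(1,3)], THEN hballD]
  have "r \<le> singleton S u u"
    using assms(3) eq_refl by (simp add: singleton_def)
  then show ?thesis by (rule positive)
qed

lemma positivity_cover:
  fixes r :: "'h::frame"
  assumes "r \<le> positivity_predicate S T Pos" "r \<le> carr S u" "r \<le> subsets S V"
    and "r \<le> Pos u" "r \<le> T u V"
  shows "r \<le> (\<^bold>\<exists>v\<^bold>\<in>V. Pos v)"
proof -
  have "r \<le> (\<^bold>\<forall>u\<^bold>\<in>carr S. \<^bold>\<forall>V\<^bold>\<in>subsets S. Pos u \<^bold>\<and> T u V \<^bold>\<longrightarrow> (\<^bold>\<exists>v\<^bold>\<in>V. Pos v))"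
    using assms(1) by (simp add: positivity_predicate_def)
  from this[THEN hballD, OF assms(2), THEN hballD, OF assms(3)] show ?thesis
    by (rule himpD) (simp add: assms)
qed

lemma subsets_negative:
  fixes r :: "'h::frame"
  assumes S: "r \<le> bounded_distributive_lattice S" and Pos: "r \<le> subsets S Pos"
  shows "r \<le> subsets S (\<lambda>u. carr S u \<^bold>\<and> \<^bold>\<not> Pos u)"
proof (rule subsetsI)
  fix x y s
  assume s: "s \<le> r" "s \<le> carr S x" "s \<le> carr S y" "s \<le> (carr S x \<^bold>\<and> \<^bold>\<not> Pos x)"
    "s \<le> eq S x y"
  have "s \<le> (\<^bold>\<not> Pos y)"
  proof (rule hnotI)
    fix t assume t: "t \<le> s" "t \<le> Pos y"
    note at_t = order_trans[OF t(1)]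
    interpret lattice_at_stage S t
      using at_t[OF order_trans[OF s(1) S]] by unfold_locales
    have "t \<le> Pos x"
      using subsets_eq[OF at_t[OF order_trans[OF s(1) Pos]] t(2)] eq_sym at_t s by blast
    moreover have "t \<le> (\<^bold>\<not> Pos x)"
      using at_t[OF s(4)] by simp
    ultimately show "t \<le> \<^bold>\<bottom>" by (meson hnotD)
  qed
  then show "s \<le> (carr S y \<^bold>\<and> \<^bold>\<not> Pos y)" using s by simp
qed simp


section \<open>Overt closed sublocales are located\<close>

lemma negative_if_covered_by_empty:
  fixes r :: "'h::frame"
  assumes Pos: "r \<le> positivity_predicate S T Pos" and u: "r \<le> carr S u"
    and T: "r \<le> T u (\<lambda>x. \<^bold>\<bottom>)"
  shows "r \<le> (\<^bold>\<not> Pos u)"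
proof (rule hnotI)
  fix s assume sr: "s \<le> r" and "s \<le> Pos u"
  then have "s \<le> (\<^bold>\<exists>v\<^bold>\<in>(\<lambda>x. \<^bold>\<bottom>). Pos v)"
    using order_trans[OF sr T]
    by (intro positivity_cover[OF order_trans[OF sr Pos], OF order_trans[OF sr u] subsets_empty])
  then show "s \<le> \<^bold>\<bottom>" by (simp add: hbex_def)
qed

lemma covered_by_empty_if_in_complement:
  fixes r :: "'h::frame"
  assumes S: "r \<le> bounded_distributive_lattice S" and U: "r \<le> subsets S U"
    and TU: "r \<le> coincide S T (closed_complement S U)"
    and v: "r \<le> carr S v" and us: "r \<le> finite_families U us" "r \<le> le S v (finite_join S us)"
  shows "r \<le> T v (\<lambda>x. \<^bold>\<bottom>)"
proof -
  have "r \<le> cover S v U"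
    using S U v us by (rule cover_if_le_finite_join)
  then show ?thesis
    using coincide_iff[OF TU v subsets_empty] by (simp add: closed_complement_def union_def)
qed

text \<open>
  A cover of \<open>u\<close> in \<open>T\<close> by its positive part is a cover by this part and \<open>U\<close> in the ambient
  locale. Compactness makes the cover of \<open>v\<close> finite, which is what allows to decide whether the
  positive part was used.
\<close>

lemma positivity_well_inside_cases:
  fixes r :: "'h::frame"
  assumes S: "r \<le> bounded_distributive_lattice S" and U: "r \<le> subsets S U"
    and TU: "r \<le> coincide S T (closed_complement S U)"
    and Pos: "r \<le> positivity_predicate S T Pos"
    and u: "r \<le> carr S u" and v: "r \<le> carr S v" and vu: "r \<le> well_inside S v u"
  shows "r \<le> (\<^bold>\<not> Pos v \<^bold>\<or> Pos u)"
proof -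
  let ?W = "\<lambda>x. singleton S u x \<^bold>\<and> Pos x"
  have subPos: "r \<le> subsets S Pos"
    using Pos by (simp add: positivity_predicate_def)
  have "r \<le> subsets S ?W"
    by (rule subsets_inter[OF subsets_singleton[OF S u] subPos])
  then have "r \<le> cover S u (union ?W U)"
    using positivity_singleton[OF S Pos u] coincide_iff[OF TU u] 
    unfolding closed_complement_def by blast
  then have "r \<le> (\<^bold>\<exists>us\<^bold>\<in>finite_families (union ?W U). le S v (finite_join S us))"
    using v vu by (rule coverD)
  then show ?thesis
  proof (rule hbexE)
    fix us s
    assume s: "s \<le> r" "s \<le> finite_families (union ?W U) us" "s \<le> le S v (finite_join S us)"
    from s(2) finite_families_union_cases
    have "s \<le> ((\<^bold>\<exists>x\<^bold>\<in>?W. top) \<^bold>\<or> finite_families U us)"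
      by (rule order_trans)
    then show "s \<le> (\<^bold>\<not> Pos v \<^bold>\<or> Pos u)"
    proof (rule hdisjE)
      fix t assume t: "t \<le> s" "t \<le> (\<^bold>\<exists>x\<^bold>\<in>?W. top)"
      from t(2) have "t \<le> Pos u"
      proof (rule hbexE)
        fix x t' assume "t' \<le> t" and x: "t' \<le> ?W x"
        then have "t' \<le> r"
          using s(1) t(1) by (meson order_trans)
        show "t' \<le> Pos u"
          by (rule subsets_eq[of _ S _ x])
            (use x order_trans[OF \<open>t' \<le> r\<close>] subPos u in \<open>auto simp: singleton_def\<close>)
      qed
      then show "t \<le> (\<^bold>\<not> Pos v \<^bold>\<or> Pos u)" by (rule le_supI2)
    next
      fix t assume t: "t \<le> s" "t \<le> finite_families U us"
      note at_t = order_trans[OF order_trans[OF t(1) s(1)]]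
      have "t \<le> T v (\<lambda>x. \<^bold>\<bottom>)"
        using at_t[OF S] at_t[OF U] at_t[OF TU] at_t[OF v] t(2) order_trans[OF t(1) s(3)]
        by (rule covered_by_empty_if_in_complement)
      with at_t[OF Pos] at_t[OF v] have "t \<le> (\<^bold>\<not> Pos v)"
        by (rule negative_if_covered_by_empty)
      then show "t \<le> (\<^bold>\<not> Pos v \<^bold>\<or> Pos u)" by (rule le_supI1)
    qed
  qed
qed

lemma positivity_imp_located_predicate:
  fixes r :: "'h::frame"
  assumes S: "r \<le> bounded_distributive_lattice S" and T: "r \<le> sublocale_of S T"
    and U: "r \<le> subsets S U" and TU: "r \<le> coincide S T (closed_complement S U)"
    and Pos: "r \<le> positivity_predicate S T Pos"
  shows "r \<le> located_predicate S Pos"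
proof -
  have "r \<le> (\<^bold>\<forall>u\<^bold>\<in>carr S. \<^bold>\<forall>v\<^bold>\<in>carr S. well_inside S v u \<^bold>\<longrightarrow> \<^bold>\<not> Pos v \<^bold>\<or> Pos u)"
  proof (intro hballI himpI)
    fix u v s1 s2 s assume s: "s1 \<le> r" "s1 \<le> carr S u" "s2 \<le> s1" "s2 \<le> carr S v"
      "s \<le> s2" "s \<le> well_inside S v u"
    then have sr: "s \<le> r" and uv: "s \<le> carr S u" "s \<le> carr S v"
      by (meson order_trans)+
    note at_s = order_trans[OF sr]
    show "s \<le> (\<^bold>\<not> Pos v \<^bold>\<or> Pos u)"
      using at_s[OF S] at_s[OF U] at_s[OF TU] at_s[OF Pos] uv s(6)
      by (rule positivity_well_inside_cases)
  qed
  moreover have "r \<le> (\<^bold>\<forall>u\<^bold>\<in>carr S. \<^bold>\<forall>U\<^bold>\<in>subsets S. cover S u U \<^bold>\<and> Pos u \<^bold>\<longrightarrow> (\<^bold>\<exists>u'\<^bold>\<in>U. Pos u'))"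
  proof (intro hballI himpI)
    fix u V s1 s2 s assume s: "s1 \<le> r" "s1 \<le> carr S u" "s2 \<le> s1" "s2 \<le> subsets S V"
      "s \<le> s2" "s \<le> (cover S u V \<^bold>\<and> Pos u)"
    then have s': "s \<le> r" "s \<le> carr S u" "s \<le> subsets S V" by (meson order_trans)+
    have "s \<le> T u V"
      using order_trans[OF s'(1) T] s'(2,3) by (rule sublocale_cover) (use s(6) in simp)
    then show "s \<le> (\<^bold>\<exists>u'\<^bold>\<in>V. Pos u')"
      using s(6) by (intro positivity_cover[OF order_trans[OF s'(1) Pos], OF s'(2,3)]) auto
  qed
  ultimately show ?thesis
    using Pos by (simp add: located_predicate_def positivity_predicate_def)
qed

text \<open>
  The opens in \<open>U\<close> are negative because \<open>T\<close> covers them by the empty set, so \<open>\<not> Pos\<close> removes at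
  least as much as \<open>U\<close>. It removes no more, since a negative open is covered in \<open>T\<close> by its
  positive part, which is empty.
\<close>

lemma positivity_imp_complement_of_negative:
  fixes r :: "'h::frame"
  assumes S: "r \<le> bounded_distributive_lattice S" and T: "r \<le> sublocale_of S T"
    and U: "r \<le> subsets S U" and TU: "r \<le> coincide S T (closed_complement S U)"
    and Pos: "r \<le> positivity_predicate S T Pos"
  shows "r \<le> coincide S T (closed_complement S (\<lambda>u. carr S u \<^bold>\<and> \<^bold>\<not> Pos u))"
  unfolding coincide_def
proof (intro hballI hiffI)
  let ?N = "\<lambda>u. carr S u \<^bold>\<and> \<^bold>\<not> Pos u"
  fix a V s1 s2 s
  assume "s1 \<le> r" "s1 \<le> carr S a" "s2 \<le> s1" "s2 \<le> subsets S V" "s \<le> s2"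
  then have sr: "s \<le> r" and a: "s \<le> carr S a" and V: "s \<le> subsets S V"
    by (meson order_trans)+
  note at_s = order_trans[OF sr]
  show "s \<le> closed_complement S ?N a V" if "s \<le> T a V"
  proof -
    have "s \<le> cover S a (union V U)"
      using that coincide_iff[OF at_s[OF TU] a V] by (simp add: closed_complement_def)
    then have "s \<le> cover S a (union V ?N)"
    proof (rule cover_mono)
      fix x t assume "t \<le> s" and x: "t \<le> union V U x"
      from x show "t \<le> union V ?N x"
      proof (rule unionE)
        fix t' assume t': "t' \<le> t" "t' \<le> U x"
        have "t' \<le> r" using \<open>t' \<le> t\<close> \<open>t \<le> s\<close> sr by (meson order_trans)
        note at_t' = order_trans[OF this]
        interpret lattice_at_stage S t'
          using at_t'[OF S] by unfold_locales
        have x: "t' \<le> carr S x"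
          using at_t'[OF U] t'(2) by (rule subsets_carr)
        have "t' \<le> finite_families U [x]"
          using t'(2) by (simp add: finite_families_def)
        with lattice at_t'[OF U] at_t'[OF TU] x have "t' \<le> T x (\<lambda>x. \<^bold>\<bottom>)"
          using le_finite_join_singleton[OF x] by (rule covered_by_empty_if_in_complement)
        with at_t'[OF Pos] x have "t' \<le> (\<^bold>\<not> Pos x)"
          by (rule negative_if_covered_by_empty)
        then show "t' \<le> union V ?N x"
          using x by (intro unionI2) simp
      qed (rule unionI1)
    qed
    then show ?thesis by (simp add: closed_complement_def)
  qed
  show "s \<le> T a V" if "s \<le> closed_complement S ?N a V"
  proof -
    have "r \<le> subsets S Pos"
      using Pos by (simp add: positivity_predicate_def)
    then have VN: "s \<le> subsets S (union V ?N)"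
      by (rule subsets_union[OF V subsets_negative[OF at_s[OF S] at_s]])
    have "s \<le> T a (union V ?N)"
      using that unfolding closed_complement_def
      by (rule sublocale_cover[OF at_s[OF T], OF a VN])
    show ?thesis
    proof (rule sublocale_trans[OF at_s[OF T], OF a VN V \<open>s \<le> T a (union V ?N)\<close>])
      fix x t assume "t \<le> s" and x: "t \<le> union V ?N x"
      from x show "t \<le> T x V"
      proof (rule unionE)
        fix t' assume t': "t' \<le> t" "t' \<le> V x"
        note at_t' = order_trans[OF order_trans[OF \<open>t' \<le> t\<close> \<open>t \<le> s\<close>]]
        from at_t'[OF at_s[OF S]] at_t'[OF at_s[OF T]] at_t'[OF V] t'(2)
        show "t' \<le> T x V" by (rule sublocale_refl[where U = V])
      next
        fix t' assume t': "t' \<le> t" "t' \<le> ?N x"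
        have ts: "t' \<le> s" using \<open>t' \<le> t\<close> \<open>t \<le> s\<close> by (rule order_trans)
        note at_t' = order_trans[OF order_trans[OF ts sr]]
        let ?W = "\<lambda>y. singleton S x y \<^bold>\<and> Pos y"
        have x: "t' \<le> carr S x" and Nx: "t' \<le> (\<^bold>\<not> Pos x)" using t'(2) by simp_all
        have W: "t' \<le> subsets S ?W"
          by (rule subsets_inter[OF subsets_singleton[OF at_t'[OF S] x]
                at_t'[OF \<open>r \<le> subsets S Pos\<close>]])
        show "t' \<le> T x V"
        proof (rule sublocale_trans[OF at_t'[OF T], OF x W order_trans[OF ts V]])
          show "t' \<le> T x ?W"
            using at_t'[OF S] at_t'[OF Pos] x by (rule positivity_singleton)
        next
          fix y q assume q: "q \<le> t'" "q \<le> ?W y"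
          note at_q = order_trans[OF q(1)]
          have "q \<le> Pos x"
            by (rule subsets_eq[of _ S _ y])
              (use q at_q[OF x] at_q[OF at_t'[OF \<open>r \<le> subsets S Pos\<close>]] in \<open>auto simp: singleton_def\<close>)
          with at_q[OF Nx] show "q \<le> T y V" by (rule hnotD)
        qed
      qed
    qed
  qed
qed

lemma overt_imp_located:
  fixes r :: "'h::frame"
  assumes S: "r \<le> bounded_distributive_lattice S" and T: "r \<le> closed_sublocale S T"
    and ov: "r \<le> overt S T"
  shows "r \<le> located S T"
proof -
  have T1: "r \<le> sublocale_of S T"
    and T2: "r \<le> (\<^bold>\<exists>U\<^bold>\<in>subsets S. coincide S T (closed_complement S U))"
    using T by (simp_all add: closed_sublocale_def)
  from T2 show ?thesis
  proof (rule hbexE)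
    fix U s
    assume s: "s \<le> r" "s \<le> subsets S U" "s \<le> coincide S T (closed_complement S U)"
    have "s \<le> (\<^bold>\<exists>Pos\<^bold>\<in>subsets S. positivity_predicate S T Pos)"
      using s(1) ov unfolding overt_def by (rule order_trans)
    then show "s \<le> located S T"
    proof (rule hbexE)
      fix Pos t
      assume t: "t \<le> s" "t \<le> subsets S Pos" "t \<le> positivity_predicate S T Pos"
      note at_t = order_trans[OF t(1)] and at_t' = order_trans[OF order_trans[OF t(1) s(1)]]
      note facts = at_t'[OF S] at_t'[OF T1] at_t[OF s(2)] at_t[OF s(3)] t(3)
      show "t \<le> located S T"
        unfolding located_def
        using t(2) positivity_imp_located_predicate[OF facts]
          positivity_imp_complement_of_negative[OF facts] by (intro hbexI) simp_all
    qed
  qed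
qed


section \<open>Located closed sublocales are overt\<close>

lemma located_well_inside_cases:
  fixes r :: "'h::frame"
  assumes "r \<le> located_predicate S Pos" "r \<le> carr S u" "r \<le> carr S v" "r \<le> well_inside S v u"
  shows "r \<le> (\<^bold>\<not> Pos v \<^bold>\<or> Pos u)"
proof -
  have "r \<le> (\<^bold>\<forall>u\<^bold>\<in>carr S. \<^bold>\<forall>v\<^bold>\<in>carr S. well_inside S v u \<^bold>\<longrightarrow> \<^bold>\<not> Pos v \<^bold>\<or> Pos u)"
    using assms(1) by (simp add: located_predicate_def)
  from this[THEN hballD, OF assms(2), THEN hballD, OF assms(3), THEN himpD, OF assms(4)] show ?thesis .
qed

lemma located_cover:
  fixes r :: "'h::frame"
  assumes "r \<le> located_predicate S Pos" "r \<le> carr S u" "r \<le> subsets S U"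
    and "r \<le> cover S u U" "r \<le> Pos u"
  shows "r \<le> (\<^bold>\<exists>u'\<^bold>\<in>U. Pos u')"
proof -
  have "r \<le> (\<^bold>\<forall>u\<^bold>\<in>carr S. \<^bold>\<forall>U\<^bold>\<in>subsets S. cover S u U \<^bold>\<and> Pos u \<^bold>\<longrightarrow> (\<^bold>\<exists>u'\<^bold>\<in>U. Pos u'))"
    using assms(1) by (simp add: located_predicate_def)
  from this[THEN hballD, OF assms(2), THEN hballD, OF assms(3)] show ?thesis
    by (rule himpD) (simp add: assms)
qed

text \<open>
  The covering relation looks only at the elements \<open>y\<close> well inside \<open>x\<close>, and for these locatedness
  decides between the two ways of being covered.
\<close>

lemma located_covers_by_positive:
  fixes r :: "'h::frame"
  assumes S: "r \<le> bounded_distributive_lattice S" and Pos: "r \<le> located_predicate S Pos"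
    and U: "r \<le> subsets S U" and x: "r \<le> U x"
  shows "r \<le> cover S x (union (\<lambda>u. U u \<^bold>\<and> Pos u) (\<lambda>u. carr S u \<^bold>\<and> \<^bold>\<not> Pos u))"
  unfolding cover_def
proof (intro hballI himpI)
  let ?W = "union (\<lambda>u. U u \<^bold>\<and> Pos u) (\<lambda>u. carr S u \<^bold>\<and> \<^bold>\<not> Pos u)"
  fix y s1 s assume s: "s1 \<le> r" "s1 \<le> carr S y" "s \<le> s1" and yx: "s \<le> well_inside S y x"
  have sr: "s \<le> r" and y: "s \<le> carr S y" using s by (meson order_trans)+
  note at_s = order_trans[OF sr]
  have cx: "s \<le> carr S x"
    using at_s[OF U] at_s[OF x] by (rule subsets_carr)
  have "s \<le> (\<^bold>\<not> Pos y \<^bold>\<or> Pos x)"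
    using at_s[OF Pos] cx y yx by (rule located_well_inside_cases)
  then show "s \<le> (\<^bold>\<exists>us\<^bold>\<in>finite_families ?W. le S y (finite_join S us))"
  proof (rule hdisjE)
    fix t assume t: "t \<le> s" "t \<le> (\<^bold>\<not> Pos y)"
    note at_t = order_trans[OF t(1)]
    interpret lattice_at_stage S t
      using at_t[OF at_s[OF S]] by unfold_locales
    have "t \<le> ?W y"
      using t(2) at_t[OF y] by (intro unionI2) simp
    then have "t \<le> finite_families ?W [y]"
      by (simp add: finite_families_def)
    then show "t \<le> (\<^bold>\<exists>us\<^bold>\<in>finite_families ?W. le S y (finite_join S us))"
      using le_finite_join_singleton[OF at_t[OF y]] by (rule hbexI)
  next
    fix t assume t: "t \<le> s" "t \<le> Pos x"
    note at_t = order_trans[OF t(1)]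
    interpret lattice_at_stage S t
      using at_t[OF at_s[OF S]] by unfold_locales
    have "t \<le> ?W x"
      using t(2) at_t[OF at_s[OF x]] by (intro unionI1) simp
    then have W: "t \<le> finite_families ?W [x]"
      by (simp add: finite_families_def)
    have x': "t \<le> carr S (finite_join S [x])"
      using at_t[OF cx] by (intro finite_join_carr) (simp add: finite_families_def)
    have "t \<le> le S y x"
      using lattice at_t[OF y] at_t[OF cx] at_t[OF yx] by (rule le_if_well_inside)
    then have "t \<le> le S y (finite_join S [x])"
      using le_finite_join_singleton[OF at_t[OF cx]] 
      by (rule le_trans[OF at_t[OF y] at_t[OF cx] x'])
    with W show "t \<le> (\<^bold>\<exists>us\<^bold>\<in>finite_families ?W. le S y (finite_join S us))"
      by (rule hbexI)
  qed
qed

lemma located_imp_positivity_predicate: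
  fixes r :: "'h::frame"
  assumes S: "r \<le> bounded_distributive_lattice S" and Pos: "r \<le> located_predicate S Pos"
    and TN: "r \<le> coincide S T (closed_complement S (\<lambda>u. carr S u \<^bold>\<and> \<^bold>\<not> Pos u))"
  shows "r \<le> positivity_predicate S T Pos"
proof -
  let ?N = "\<lambda>u. carr S u \<^bold>\<and> \<^bold>\<not> Pos u"
  have subPos: "r \<le> subsets S Pos"
    using Pos by (simp add: located_predicate_def)
  moreover have "r \<le> (\<^bold>\<forall>U\<^bold>\<in>subsets S. \<^bold>\<forall>x\<^bold>\<in>U. T x (\<lambda>u. U u \<^bold>\<and> Pos u))"
  proof (intro hballI)
    fix U x s1 s assume s: "s1 \<le> r" "s1 \<le> subsets S U" "s \<le> s1" and x: "s \<le> U x"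
    have sr: "s \<le> r" and U: "s \<le> subsets S U" using s by (meson order_trans)+
    note at_s = order_trans[OF sr]
    have "s \<le> subsets S (\<lambda>u. U u \<^bold>\<and> Pos u)"
      using U at_s[OF subPos] by (rule subsets_inter)
    moreover have "s \<le> carr S x"
      using U x by (rule subsets_carr)
    ultimately show "s \<le> T x (\<lambda>u. U u \<^bold>\<and> Pos u)"
      using located_covers_by_positive[OF at_s[OF S] at_s[OF Pos] U x] coincide_iff[OF at_s[OF TN]]
      unfolding closed_complement_def by blast
  qed
  moreover have "r \<le> (\<^bold>\<forall>u\<^bold>\<in>carr S. \<^bold>\<forall>V\<^bold>\<in>subsets S. Pos u \<^bold>\<and> T u V \<^bold>\<longrightarrow> (\<^bold>\<exists>v\<^bold>\<in>V. Pos v))"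
  proof (intro hballI himpI)
    fix u V s1 s2 s assume s: "s1 \<le> r" "s1 \<le> carr S u" "s2 \<le> s1" "s2 \<le> subsets S V" "s \<le> s2"
      and uV: "s \<le> (Pos u \<^bold>\<and> T u V)"
    then have sr: "s \<le> r" and u: "s \<le> carr S u" and V: "s \<le> subsets S V"
      by (meson order_trans)+
    note at_s = order_trans[OF sr]
    have VN: "s \<le> subsets S (union V ?N)"
      by (rule subsets_union[OF V subsets_negative[OF at_s[OF S] at_s[OF subPos]]])
    have "s \<le> cover S u (union V ?N)"
      using uV coincide_iff[OF at_s[OF TN] u V] by (simp add: closed_complement_def)
    then have "s \<le> (\<^bold>\<exists>v\<^bold>\<in>union V ?N. Pos v)"
      using uV by (intro located_cover[OF at_s[OF Pos] u VN]) auto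
    then show "s \<le> (\<^bold>\<exists>v\<^bold>\<in>V. Pos v)"
    proof (rule hbexE)
      fix v t assume v: "t \<le> union V ?N v" and Pv: "t \<le> Pos v"
      from v show "t \<le> (\<^bold>\<exists>v\<^bold>\<in>V. Pos v)"
      proof (rule unionE)
        fix q assume q: "q \<le> t" "q \<le> V v"
        from q(2) order_trans[OF q(1) Pv] show "q \<le> (\<^bold>\<exists>v\<^bold>\<in>V. Pos v)"
          by (rule hbexI)
      next
        fix q assume q: "q \<le> t" "q \<le> ?N v"
        then have "q \<le> (\<^bold>\<not> Pos v)" by simp
        then show "q \<le> (\<^bold>\<exists>v\<^bold>\<in>V. Pos v)"
          using order_trans[OF q(1) Pv] by (rule hnotD)
      qed
    qed
  qed
  ultimately show ?thesis
    by (simp add: positivity_predicate_def)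
qed

lemma located_imp_overt:
  fixes r :: "'h::frame"
  assumes S: "r \<le> bounded_distributive_lattice S" and loc: "r \<le> located S T"
  shows "r \<le> overt S T"
  using loc unfolding located_def
proof (rule hbexE)
  fix Pos s
  assume s: "s \<le> r" "s \<le> subsets S Pos" "s \<le> (located_predicate S Pos \<^bold>\<and>
    coincide S T (closed_complement S (\<lambda>u. carr S u \<^bold>\<and> \<^bold>\<not> Pos u)))"
  then have "s \<le> positivity_predicate S T Pos"
    using S by (intro located_imp_positivity_predicate) (auto intro: order_trans)
  then show "s \<le> overt S T"
    unfolding overt_def using s(2) by (intro hbexI[where x = Pos])
qed

theorem theorem4:
  fixes S :: "('a, 'h::frame) hlattice"
    and T :: "('a, 'h) relation"
  shows "\<turnstile> normal_distributive_lattice S \<^bold>\<and> closed_sublocale S T \<^bold>\<longrightarrow>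
           (overt S T \<^bold>\<longleftrightarrow> located S T)"
proof -
  have "top \<le> (normal_distributive_lattice S \<^bold>\<and> closed_sublocale S T \<^bold>\<longrightarrow>
           (overt S T \<^bold>\<longleftrightarrow> located S T))"
  proof (intro himpI hiffI)
    fix s t
    assume s: "s \<le> (normal_distributive_lattice S \<^bold>\<and> closed_sublocale S T)" and t: "t \<le> s"
    have S: "t \<le> bounded_distributive_lattice S" and T: "t \<le> closed_sublocale S T"
      using order_trans[OF t s] by (simp_all add: normal_distributive_lattice_def)
    show "t \<le> located S T" if "t \<le> overt S T"
      using S T that by (rule overt_imp_located)
    show "t \<le> overt S T" if "t \<le> located S T"
      using S that by (rule located_imp_overt)
  qed
  then show ?thesis
    by (simp add: holds_def top_unique)
qed

end
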